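(* (Consistency.) Let $(\mathcal S,\mathcal A,\mathcal R)$ be any normalizing Pure Type System. Then for every variable $x$ and every sort $s\in\mathcal S$ there is no term $M$ such that $[]\vdash M:\Pi[x:s]x$, where $[]$ is the empty context.
   Context: Syntax. Fix a type $\mathcal S$ of sorts (used as constants) and a countably infinite type $\mathcal V$ of variables with decidable equality and a fixed enumeration. Raw terms $\Lambda$ (NOT identified up to $\alpha$): $M,N,A,B::= s \mid x \mid \lambda[x:A]M \mid \Pi[x:A]B \mid M\cdot N$ with $s\in\mathcal S$, $x\in\mathcal V$. $\mathrm{fv}(M)$ is the (finite list of) free variables, where $\lambda[x:A]M$ and $\Pi[x:A]M$ bind $x$ in $M$ but not in $A$; $\mathrm{fv}(M)-x$ is $\mathrm{fv}(M)$ with $x$ removed. $\equiv$ is syntactic identity. Substitution (Stoughton). A substitution is a function $\sigma:\mathcal V\to\Lambda$; $\iota$ is the identity; $(\sigma,x:=N)$ maps $x$ to $N$ and any other $y$ to $\sigma y$. For a finite list $xs$ of variables, $X(\sigma,xs)$ is the first variable (in the enumeration) not occurring free in $\sigma y$ for any $y\in xs$. Define $s\bullet\sigma=s$, $x\bullet\sigma=\sigma x$, $(M\cdot N)\bullet\sigma=(M\bullet\sigma)\cdot(N\bullet\sigma)$, and for $Q\in\{\lambda,\Pi\}$, $(Q[x:A]M)\bullet\sigma=Q[y:A\bullet\sigma](M\bullet(\sigma,x:=y))$ where $y=X(\sigma,\mathrm{fv}(M)-x)$. Write $M[x:=N]$ for $M\bullet(\iota,x:=N)$. $\alpha$-conversion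 $\sim_\alpha$ is inductively defined by: $s\sim_\alpha s$; $x\sim_\alpha x$; if $M\sim_\alpha M'$ and $N\sim_\alpha N'$ then $M\cdot N\sim_\alpha M'\cdot N'$; for $Q\in\{\lambda,\Pi\}$, if $A\sim_\alpha A'$ and $M[x:=y]\equiv M'[x':=y]$ for some $y\notin\mathrm{fv}(M)-x$, $y\notin\mathrm{fv}(M')-x'$, then $Q[x:A]M\sim_\alpha Q[x':A']M'$. $\beta$. $\to_\beta$ is the contextual closure (under both positions of application, and both the domain and the body of $\lambda$ and $\Pi$) of $(\lambda[x:A]M)\cdot N\triangleright_\beta M[x:=N]$. $\twoheadrightarrow_\beta$ is its reflexive-transitive closure. $\simeq_\beta$ is the least equivalence relation containing $\sim_\alpha$ and $\to_\beta$. Pure Type System. It is specified by sorts $\mathcal S$, axioms $\mathcal A\subseteq\mathcal S^2$ and rules $\mathcal R\subseteq\mathcal S^3$ (arbitrary relations). Contexts are finite lists of pairs $(x,A)\in\mathcal V\times\Lambda$; $\Gamma,x:A$ extends $\Gamma$ by $(x,A)$; $\mathrm{dom}\,\Gamma$ is the list of its variables. The judgments $\Gamma\ \mathsf{ok}$ and $\Gamma\vdash M:A$ are mutually inductively defined by: - $[]\ \mathsf{ok}$; if $\Gamma\ \mathsf{ok}$, $\Gamma\vdash A:s$ and $x\notin\mathrm{dom}\,\Gamma$ then $(\Gamma,x:A)\ \mathsf{ok}$. - (sort) if $\Gamma\ \mathsf{ok}$ and $\mathcal A\,s_1\,s_2$ then $\Gamma\vdash s_1:s_2$. - (var) if $\Gamma\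 \mathsf{ok}$ and $(x,A)\in\Gamma$ then $\Gamma\vdash x:A$. - (prod) if $\Gamma\vdash A:s_1$, $\Gamma,y:A\vdash B[x:=y]:s_2$, $\mathcal R\,s_1\,s_2\,s_3$ and $y\notin\mathrm{fv}(B)-x$ then $\Gamma\vdash\Pi[x:A]B:s_3$. - (abs) if $\Gamma\vdash A:s_1$, $\Gamma,z:A\vdash M[x:=z]:B[y:=z]$, $\Gamma,z:A\vdash B[y:=z]:s_2$, $\mathcal R\,s_1\,s_2\,s_3$, $z\notin\mathrm{fv}(M)-x$ and $z\notin\mathrm{fv}(B)-y$ then $\Gamma\vdash\lambda[x:A]M:\Pi[y:A]B$. - (app) if $\Gamma\vdash M:\Pi[x:A]B$ and $\Gamma\vdash N:A$ then $\Gamma\vdash M\cdot N:B[x:=N]$. - (conv) if $\Gamma\vdash M:A$, $\Gamma\vdash B:s$ and $A\simeq_\beta B$ then $\Gamma\vdash M:B$. Normalization. $\mathsf{nf}\,M$ means there is no $N$ with $M\to_\beta N$. $M$ is weakly normalizing if there is $N$ with $\mathsf{nf}\,N$ and $M\twoheadrightarrow_\beta N$. The PTS is normalizing if for all $\Gamma,M,A$ with $\Gamma\vdash M:A$, both $M$ and $A$ are weakly normalizing. *)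

theory Defs
  imports Main
begin

text \<open>Variables form an arbitrary countably infinite type, given by an enumeration without repetitions.\<close>

class variable =
  fixes var_enum :: "nat \<Rightarrow> 'a"
  assumes bij_var_enum: "bij var_enum"

instantiation nat :: variable
begin
definition var_enum_nat :: "nat \<Rightarrow> nat" where "var_enum_nat = id"
instance by standard (simp add: var_enum_nat_def)
end

text \<open>Raw terms are not identified up to alpha-conversion.  In \<open>Lam x A M\<close> and \<open>Pi x A M\<close>
  the variable \<open>x\<close> is bound in \<open>M\<close> but not in \<open>A\<close>.\<close>

datatype ('s, 'v) tm =
    Sort 's
  | Var 'v
  | Lam 'v "('s, 'v) tm" "('s, 'v) tm"
  | Pi 'v "('s, 'v) tm" "('s, 'v) tm"
  | App "('s, 'v) tm" "('s, 'v) tm"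

primrec fv :: "('s, 'v) tm \<Rightarrow> 'v list" where
  "fv (Sort s) = []"
| "fv (Var x) = [x]"
| "fv (Lam x A M) = fv A @ removeAll x (fv M)"
| "fv (Pi x A M) = fv A @ removeAll x (fv M)"
| "fv (App M N) = fv M @ fv N"

text \<open>Stoughton's simultaneous substitution.  The update \<open>(\<sigma>, x := N)\<close> is the function update
  \<open>\<sigma>(x := N)\<close>, and the identity substitution \<open>\<iota>\<close> is \<open>Var\<close>.\<close>

definition fresh_var :: "('v::variable \<Rightarrow> ('s, 'v) tm) \<Rightarrow> 'v list \<Rightarrow> 'v" where
  "fresh_var \<sigma> xs = var_enum (LEAST n. \<forall>y\<in>set xs. var_enum n \<notin> set (fv (\<sigma> y)))"

primrec subst :: "('s, 'v::variable) tm \<Rightarrow> ('v \<Rightarrow> ('s, 'v) tm) \<Rightarrow> ('s, 'v) tm"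
  (infixl "\<bullet>" 75) where
  "Sort s \<bullet> \<sigma> = Sort s"
| "Var x \<bullet> \<sigma> = \<sigma> x"
| "Lam x A M \<bullet> \<sigma> =
     (let y = fresh_var \<sigma> (removeAll x (fv M)) in Lam y (A \<bullet> \<sigma>) (M \<bullet> \<sigma>(x := Var y)))"
| "Pi x A M \<bullet> \<sigma> =
     (let y = fresh_var \<sigma> (removeAll x (fv M)) in Pi y (A \<bullet> \<sigma>) (M \<bullet> \<sigma>(x := Var y)))"
| "App M N \<bullet> \<sigma> = App (M \<bullet> \<sigma>) (N \<bullet> \<sigma>)"

definition subst1 :: "('s, 'v::variable) tm \<Rightarrow> 'v \<Rightarrow> ('s, 'v) tm \<Rightarrow> ('s, 'v) tm"
  ("_[_ ::= _]" [100, 0, 0] 100) where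
  "M[x ::= N] = M \<bullet> Var(x := N)"

inductive alpha :: "('s, 'v::variable) tm \<Rightarrow> ('s, 'v) tm \<Rightarrow> bool" (infix "\<sim>\<^sub>\<alpha>" 50) where
  alpha_Sort: "Sort s \<sim>\<^sub>\<alpha> Sort s"
| alpha_Var: "Var x \<sim>\<^sub>\<alpha> Var x"
| alpha_App: "M \<sim>\<^sub>\<alpha> M' \<Longrightarrow> N \<sim>\<^sub>\<alpha> N' \<Longrightarrow> App M N \<sim>\<^sub>\<alpha> App M' N'"
| alpha_Lam: "A \<sim>\<^sub>\<alpha> A' \<Longrightarrow> y \<notin> set (removeAll x (fv M)) \<Longrightarrow> y \<notin> set (removeAll x' (fv M')) \<Longrightarrow>
    M[x ::= Var y] = M'[x' ::= Var y] \<Longrightarrow> Lam x A M \<sim>\<^sub>\<alpha> Lam x' A' M'"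
| alpha_Pi: "A \<sim>\<^sub>\<alpha> A' \<Longrightarrow> y \<notin> set (removeAll x (fv M)) \<Longrightarrow> y \<notin> set (removeAll x' (fv M')) \<Longrightarrow>
    M[x ::= Var y] = M'[x' ::= Var y] \<Longrightarrow> Pi x A M \<sim>\<^sub>\<alpha> Pi x' A' M'"

inductive beta :: "('s, 'v::variable) tm \<Rightarrow> ('s, 'v) tm \<Rightarrow> bool" (infix "\<rightarrow>\<^sub>\<beta>" 50) where
  beta_redex: "App (Lam x A M) N \<rightarrow>\<^sub>\<beta> M[x ::= N]"
| beta_AppL: "M \<rightarrow>\<^sub>\<beta> M' \<Longrightarrow> App M N \<rightarrow>\<^sub>\<beta> App M' N"
| beta_AppR: "N \<rightarrow>\<^sub>\<beta> N' \<Longrightarrow> App M N \<rightarrow>\<^sub>\<beta> App M N'"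
| beta_LamL: "A \<rightarrow>\<^sub>\<beta> A' \<Longrightarrow> Lam x A M \<rightarrow>\<^sub>\<beta> Lam x A' M"
| beta_LamR: "M \<rightarrow>\<^sub>\<beta> M' \<Longrightarrow> Lam x A M \<rightarrow>\<^sub>\<beta> Lam x A M'"
| beta_PiL: "A \<rightarrow>\<^sub>\<beta> A' \<Longrightarrow> Pi x A M \<rightarrow>\<^sub>\<beta> Pi x A' M"
| beta_PiR: "M \<rightarrow>\<^sub>\<beta> M' \<Longrightarrow> Pi x A M \<rightarrow>\<^sub>\<beta> Pi x A M'"

abbreviation beta_reds :: "('s, 'v::variable) tm \<Rightarrow> ('s, 'v) tm \<Rightarrow> bool" (infix "\<rightarrow>\<^sub>\<beta>\<^sup>*" 50) where
  "M \<rightarrow>\<^sub>\<beta>\<^sup>* N \<equiv> beta\<^sup>*\<^sup>* M N"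

abbreviation beta_conv :: "('s, 'v::variable) tm \<Rightarrow> ('s, 'v) tm \<Rightarrow> bool" (infix "\<simeq>\<^sub>\<beta>" 50) where
  "M \<simeq>\<^sub>\<beta> N \<equiv> equivclp (sup alpha beta) M N"

text \<open>The most recent declaration is at the head of a context.\<close>

type_synonym ('s, 'v) ctx = "('v \<times> ('s, 'v) tm) list"

inductive ok :: "('s \<Rightarrow> 's \<Rightarrow> bool) \<Rightarrow> ('s \<Rightarrow> 's \<Rightarrow> 's \<Rightarrow> bool) \<Rightarrow> ('s, 'v::variable) ctx \<Rightarrow> bool"
  and typing :: "('s \<Rightarrow> 's \<Rightarrow> bool) \<Rightarrow> ('s \<Rightarrow> 's \<Rightarrow> 's \<Rightarrow> bool) \<Rightarrow> ('s, 'v) ctx \<Rightarrow>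
    ('s, 'v) tm \<Rightarrow> ('s, 'v) tm \<Rightarrow> bool"
  for Ax :: "'s \<Rightarrow> 's \<Rightarrow> bool" and Rl :: "'s \<Rightarrow> 's \<Rightarrow> 's \<Rightarrow> bool"
where
  ok_Nil: "ok Ax Rl []"
| ok_Cons: "ok Ax Rl \<Gamma> \<Longrightarrow> typing Ax Rl \<Gamma> A (Sort s) \<Longrightarrow> x \<notin> set (map fst \<Gamma>) \<Longrightarrow>
    ok Ax Rl ((x, A) # \<Gamma>)"
| ty_sort: "ok Ax Rl \<Gamma> \<Longrightarrow> Ax s1 s2 \<Longrightarrow> typing Ax Rl \<Gamma> (Sort s1) (Sort s2)"
| ty_var: "ok Ax Rl \<Gamma> \<Longrightarrow> (x, A) \<in> set \<Gamma> \<Longrightarrow> typing Ax Rl \<Gamma> (Var x) A"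
| ty_prod: "typing Ax Rl \<Gamma> A (Sort s1) \<Longrightarrow>
    typing Ax Rl ((y, A) # \<Gamma>) (B[x ::= Var y]) (Sort s2) \<Longrightarrow>
    Rl s1 s2 s3 \<Longrightarrow> y \<notin> set (removeAll x (fv B)) \<Longrightarrow>
    typing Ax Rl \<Gamma> (Pi x A B) (Sort s3)"
| ty_abs: "typing Ax Rl \<Gamma> A (Sort s1) \<Longrightarrow>
    typing Ax Rl ((z, A) # \<Gamma>) (M[x ::= Var z]) (B[y ::= Var z]) \<Longrightarrow>
    typing Ax Rl ((z, A) # \<Gamma>) (B[y ::= Var z]) (Sort s2) \<Longrightarrow>
    Rl s1 s2 s3 \<Longrightarrow> z \<notin> set (removeAll x (fv M)) \<Longrightarrow> z \<notin> set (removeAll y (fv B)) \<Longrightarrow>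
    typing Ax Rl \<Gamma> (Lam x A M) (Pi y A B)"
| ty_app: "typing Ax Rl \<Gamma> M (Pi x A B) \<Longrightarrow> typing Ax Rl \<Gamma> N A \<Longrightarrow>
    typing Ax Rl \<Gamma> (App M N) (B[x ::= N])"
| ty_conv: "typing Ax Rl \<Gamma> M A \<Longrightarrow> typing Ax Rl \<Gamma> B (Sort s) \<Longrightarrow> A \<simeq>\<^sub>\<beta> B \<Longrightarrow>
    typing Ax Rl \<Gamma> M B"

definition nf :: "('s, 'v::variable) tm \<Rightarrow> bool" where
  "nf M \<longleftrightarrow> (\<nexists>N. M \<rightarrow>\<^sub>\<beta> N)"

definition weakly_normalizing :: "('s, 'v::variable) tm \<Rightarrow> bool" where
  "weakly_normalizing M \<longleftrightarrow> (\<exists>N. nf N \<and> M \<rightarrow>\<^sub>\<beta>\<^sup>* N)"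

text \<open>The first argument only records the type of variables, which the types of the
  axioms and rules do not determine.\<close>

definition normalizing ::
  "'v::variable itself \<Rightarrow> ('s \<Rightarrow> 's \<Rightarrow> bool) \<Rightarrow> ('s \<Rightarrow> 's \<Rightarrow> 's \<Rightarrow> bool) \<Rightarrow> bool" where
  "normalizing (_ :: 'v itself) Ax Rl \<longleftrightarrow>
    (\<forall>(\<Gamma> :: ('s, 'v) ctx) M A. typing Ax Rl \<Gamma> M A \<longrightarrow> weakly_normalizing M \<and> weakly_normalizing A)"

end

theory Submission
  imports Defs "HOL-Library.Confluence"
begin

text \<open>
  Named terms are interpreted as de Bruijn terms, in which Stoughton substitution becomes ordinary
  parallel substitution and \<open>\<alpha>\<close>-convertible terms become equal; typing derivations are mapped along.
  Only this direction is needed: a closed inhabitant of \<open>\<Pi>[x:s]x\<close> yields, by normalization and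
  subject reduction for de Bruijn terms, a normal one.  In a context all of whose types are
  convertible to sorts, a normal term with a product type is an abstraction, since an application
  would have an abstraction as its head.  So the inhabitant is \<open>\<lambda>[x:A]b\<close> with \<open>A\<close> convertible
  to \<open>s\<close>, and \<open>b\<close> is normal of type \<open>x\<close>; but the type of a normal \<open>b\<close> in such a context
  is convertible to a sort or a product, and by confluence never to a variable.
\<close>

section \<open>De Bruijn terms\<close>

datatype 's dtm =
    DSort 's
  | DVar nat
  | DLam "'s dtm" "'s dtm"
  | DPi "'s dtm" "'s dtm"
  | DApp "'s dtm" "'s dtm"

definition lift_ren :: "(nat \<Rightarrow> nat) \<Rightarrow> nat \<Rightarrow> nat" where
  "lift_ren \<xi> = case_nat 0 (\<lambda>n. Suc (\<xi> n))"

primrec rename :: "'s dtm \<Rightarrow> (nat \<Rightarrow> nat) \<Rightarrow> 's dtm" where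
  "rename (DSort s) \<xi> = DSort s"
| "rename (DVar n) \<xi> = DVar (\<xi> n)"
| "rename (DLam A M) \<xi> = DLam (rename A \<xi>) (rename M (lift_ren \<xi>))"
| "rename (DPi A M) \<xi> = DPi (rename A \<xi>) (rename M (lift_ren \<xi>))"
| "rename (DApp M N) \<xi> = DApp (rename M \<xi>) (rename N \<xi>)"

definition lift_sub :: "(nat \<Rightarrow> 's dtm) \<Rightarrow> nat \<Rightarrow> 's dtm" where
  "lift_sub \<sigma> = case_nat (DVar 0) (\<lambda>n. rename (\<sigma> n) Suc)"

primrec dsubst :: "'s dtm \<Rightarrow> (nat \<Rightarrow> 's dtm) \<Rightarrow> 's dtm" where
  "dsubst (DSort s) \<sigma> = DSort s"
| "dsubst (DVar n) \<sigma> = \<sigma> n"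
| "dsubst (DLam A M) \<sigma> = DLam (dsubst A \<sigma>) (dsubst M (lift_sub \<sigma>))"
| "dsubst (DPi A M) \<sigma> = DPi (dsubst A \<sigma>) (dsubst M (lift_sub \<sigma>))"
| "dsubst (DApp M N) \<sigma> = DApp (dsubst M \<sigma>) (dsubst N \<sigma>)"

definition dsubst1 :: "'s dtm \<Rightarrow> 's dtm \<Rightarrow> 's dtm" where
  "dsubst1 M N = dsubst M (case_nat N DVar)"

lemma lift_ren_simps [simp]:
  "lift_ren \<xi> 0 = 0" "lift_ren \<xi> (Suc n) = Suc (\<xi> n)"
  by (simp_all add: lift_ren_def)

lemma lift_sub_simps [simp]:
  "lift_sub \<sigma> 0 = DVar 0" "lift_sub \<sigma> (Suc n) = rename (\<sigma> n) Suc"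
  by (simp_all add: lift_sub_def)

lemma lift_ren_comp: "(\<lambda>n. lift_ren \<zeta> (lift_ren \<xi> n)) = lift_ren (\<lambda>n. \<zeta> (\<xi> n))"
  by (rule ext) (simp add: lift_ren_def split: nat.split)

text \<open>Lifting a substitution renames by \<open>Suc\<close>, which dictates the order of the
  fusion laws: pure renaming, then the two mixed laws, then substitution after substitution.\<close>

lemma rename_rename: "rename (rename M \<xi>) \<zeta> = rename M (\<lambda>n. \<zeta> (\<xi> n))"
  by (induction M arbitrary: \<xi> \<zeta>) (simp_all add: lift_ren_comp)

lemma lift_sub_lift_ren: "(\<lambda>n. lift_sub \<sigma> (lift_ren \<xi> n)) = lift_sub (\<lambda>n. \<sigma> (\<xi> n))"
  by (rule ext) (simp add: lift_sub_def lift_ren_def split: nat.split)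

lemma dsubst_rename: "dsubst (rename M \<xi>) \<sigma> = dsubst M (\<lambda>n. \<sigma> (\<xi> n))"
  by (induction M arbitrary: \<xi> \<sigma>) (simp_all add: lift_sub_lift_ren)

lemma rename_lift_sub: "(\<lambda>n. rename (lift_sub \<sigma> n) (lift_ren \<xi>)) = lift_sub (\<lambda>n. rename (\<sigma> n) \<xi>)"
  by (rule ext) (simp add: lift_sub_def rename_rename split: nat.split)

lemma rename_dsubst: "rename (dsubst M \<sigma>) \<xi> = dsubst M (\<lambda>n. rename (\<sigma> n) \<xi>)"
  by (induction M arbitrary: \<sigma> \<xi>) (simp_all add: rename_lift_sub)

lemma dsubst_lift_sub: "(\<lambda>n. dsubst (lift_sub \<sigma> n) (lift_sub \<tau>)) = lift_sub (\<lambda>n. dsubst (\<sigma> n) \<tau>)"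
  by (rule ext) (simp add: lift_sub_def dsubst_rename rename_dsubst split: nat.split)

lemma dsubst_dsubst: "dsubst (dsubst M \<sigma>) \<tau> = dsubst M (\<lambda>n. dsubst (\<sigma> n) \<tau>)"
  by (induction M arbitrary: \<sigma> \<tau>) (simp_all add: dsubst_lift_sub)

lemma lift_sub_DVar [simp]: "lift_sub DVar = DVar"
  by (rule ext) (simp add: lift_sub_def split: nat.split)

lemma dsubst_DVar [simp]: "dsubst M DVar = M"
  by (induction M) simp_all

lemma lift_sub_DVar_comp: "lift_sub (\<lambda>n. DVar (\<xi> n)) = (\<lambda>n. DVar (lift_ren \<xi> n))"
  by (rule ext) (simp add: lift_sub_def lift_ren_def split: nat.split)

lemma rename_eq_dsubst: "rename M \<xi> = dsubst M (\<lambda>n. DVar (\<xi> n))"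
  by (induction M arbitrary: \<xi>) (simp_all add: lift_sub_DVar_comp)

lemma dsubst_dsubst1: "dsubst (dsubst1 M N) \<sigma> = dsubst1 (dsubst M (lift_sub \<sigma>)) (dsubst N \<sigma>)"
  unfolding dsubst1_def dsubst_dsubst
  by (rule arg_cong[where f = "dsubst M"], rule ext)
    (simp add: lift_sub_def dsubst_rename split: nat.split)

lemma rename_dsubst1: "rename (dsubst1 M N) \<xi> = dsubst1 (rename M (lift_ren \<xi>)) (rename N \<xi>)"
  by (simp add: rename_eq_dsubst dsubst_dsubst1 lift_sub_DVar_comp)

section \<open>Parallel reduction and confluence\<close>

text \<open>Parallel reduction of Tait and Martin-Loef, the only reduction used on de Bruijn
  terms.\<close>

inductive par :: "'s dtm \<Rightarrow> 's dtm \<Rightarrow> bool" (infix "\<Rrightarrow>" 50) where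
  par_Sort [intro]: "DSort s \<Rrightarrow> DSort s"
| par_Var [intro]: "DVar n \<Rrightarrow> DVar n"
| par_Lam [intro]: "A \<Rrightarrow> A' \<Longrightarrow> M \<Rrightarrow> M' \<Longrightarrow> DLam A M \<Rrightarrow> DLam A' M'"
| par_Pi [intro]: "A \<Rrightarrow> A' \<Longrightarrow> M \<Rrightarrow> M' \<Longrightarrow> DPi A M \<Rrightarrow> DPi A' M'"
| par_App [intro]: "M \<Rrightarrow> M' \<Longrightarrow> N \<Rrightarrow> N' \<Longrightarrow> DApp M N \<Rrightarrow> DApp M' N'"
| par_beta [intro]: "M \<Rrightarrow> M' \<Longrightarrow> N \<Rrightarrow> N' \<Longrightarrow> DApp (DLam A M) N \<Rrightarrow> dsubst1 M' N'"

inductive_cases par_SortE [elim!]: "DSort s \<Rrightarrow> N"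
inductive_cases par_VarE [elim!]: "DVar n \<Rrightarrow> N"
inductive_cases par_LamE [elim!]: "DLam A M \<Rrightarrow> N"
inductive_cases par_PiE [elim!]: "DPi A M \<Rrightarrow> N"
inductive_cases par_AppE: "DApp M P \<Rrightarrow> N"

lemma par_refl [simp, intro]: "M \<Rrightarrow> M"
  by (induction M) auto

lemma par_rename: "M \<Rrightarrow> M' \<Longrightarrow> rename M \<xi> \<Rrightarrow> rename M' \<xi>"
  by (induction arbitrary: \<xi> rule: par.induct) (auto simp: rename_dsubst1)

lemma par_lift_sub: "(\<And>n. \<sigma> n \<Rrightarrow> \<sigma>' n) \<Longrightarrow> lift_sub \<sigma> n \<Rrightarrow> lift_sub \<sigma>' n"
  by (cases n) (auto intro: par_rename)

lemma par_dsubst: "M \<Rrightarrow> M' \<Longrightarrow> (\<And>n. \<sigma> n \<Rrightarrow> \<sigma>' n) \<Longrightarrow> dsubst M \<sigma> \<Rrightarrow> dsubst M' \<sigma>'"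
  by (induction arbitrary: \<sigma> \<sigma>' rule: par.induct) (auto simp: dsubst_dsubst1 par_lift_sub)

lemma par_dsubst1: "M \<Rrightarrow> M' \<Longrightarrow> N \<Rrightarrow> N' \<Longrightarrow> dsubst1 M N \<Rrightarrow> dsubst1 M' N'"
  unfolding dsubst1_def by (rule par_dsubst) (auto split: nat.split)

text \<open>Takahashi's complete development: all redexes present in the term are contracted at
  once.\<close>

fun development :: "'s dtm \<Rightarrow> 's dtm" where
  "development (DSort s) = DSort s"
| "development (DVar n) = DVar n"
| "development (DLam A M) = DLam (development A) (development M)"
| "development (DPi A M) = DPi (development A) (development M)"
| "development (DApp (DLam A M) N) = dsubst1 (development M) (development N)"
| "development (DApp M N) = DApp (development M) (development N)"

text \<open>A parallel step contracts some redexes of \<open>M\<close>, and one further step can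
  contract the rest. So all reducts of \<open>M\<close> share the reduct
  \<open>development M\<close>, which gives the diamond property.\<close>

lemma par_development: "M \<Rrightarrow> N \<Longrightarrow> N \<Rrightarrow> development M"
  by (induction M arbitrary: N rule: development.induct)
    (auto elim!: par_AppE intro!: par_dsubst1)

lemma confluentp_par: "confluentp par"
  by (rule strong_confluentp_imp_confluentp, rule strong_confluentpI)
    (blast dest: par_development)

section \<open>Conversion of de Bruijn terms\<close>

abbreviation conv :: "'s dtm \<Rightarrow> 's dtm \<Rightarrow> bool" (infix "\<simeq>" 50) where
  "M \<simeq> N \<equiv> equivclp par M N"

text \<open>The Church-Rosser property. Reducts of sorts, variables and products keep their head, so
  a common reduct separates these three kinds and splits a conversion between products into
  components.\<close>

lemma conv_iff_common_reduct: "M \<simeq> N \<longleftrightarrow> (\<exists>P. par\<^sup>*\<^sup>* M P \<and> par\<^sup>*\<^sup>* N P)"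
  by (simp add: semiconfluentp_equivclp[OF confluentp_imp_semiconfluentp[OF confluentp_par]]
      relcompp_apply rtranclp_conversep)

lemma conv_cong: "M \<simeq> N \<Longrightarrow> (\<And>P Q. P \<Rrightarrow> Q \<Longrightarrow> f P \<Rrightarrow> f Q) \<Longrightarrow> f M \<simeq> f N"
  by (induction rule: equivclp_induct) (auto intro: equivclp_into_equivclp)

lemma conv_dsubst: "M \<simeq> N \<Longrightarrow> dsubst M \<sigma> \<simeq> dsubst N \<sigma>"
  by (rule conv_cong) (auto intro: par_dsubst)

lemma conv_dsubst1: "M \<simeq> N \<Longrightarrow> dsubst1 M P \<simeq> dsubst1 N P"
  by (simp add: dsubst1_def conv_dsubst)

lemma conv_rename: "M \<simeq> N \<Longrightarrow> rename M \<xi> \<simeq> rename N \<xi>"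
  by (rule conv_cong) (auto intro: par_rename)

lemma par_rtrancl_Sort: "par\<^sup>*\<^sup>* (DSort s) N \<Longrightarrow> N = DSort s"
  by (induction rule: rtranclp_induct) auto

lemma par_rtrancl_Var: "par\<^sup>*\<^sup>* (DVar n) N \<Longrightarrow> N = DVar n"
  by (induction rule: rtranclp_induct) auto

lemma par_rtrancl_Pi:
  "par\<^sup>*\<^sup>* (DPi A B) N \<Longrightarrow> \<exists>A' B'. N = DPi A' B' \<and> par\<^sup>*\<^sup>* A A' \<and> par\<^sup>*\<^sup>* B B'"
  by (induction rule: rtranclp_induct) (auto intro: rtranclp.rtrancl_into_rtrancl)

lemma conv_Sort_Pi: "\<not> DSort s \<simeq> DPi A B"
  by (auto simp: conv_iff_common_reduct dest!: par_rtrancl_Sort par_rtrancl_Pi)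

lemma conv_Sort_Var: "\<not> DSort s \<simeq> DVar n"
  by (auto simp: conv_iff_common_reduct dest!: par_rtrancl_Sort par_rtrancl_Var)

lemma conv_Pi_Var: "\<not> DPi A B \<simeq> DVar n"
  by (auto simp: conv_iff_common_reduct dest!: par_rtrancl_Pi par_rtrancl_Var)

lemma conv_PiD: "DPi A B \<simeq> DPi A' B' \<Longrightarrow> A \<simeq> A' \<and> B \<simeq> B'"
  by (auto simp: conv_iff_common_reduct dest!: par_rtrancl_Pi)

section \<open>Typing of de Bruijn terms\<close>

text \<open>The entry \<open>\<Gamma> ! n\<close> is a type over the declarations behind it; seen
  from the whole context it must skip \<open>n + 1\<close> declarations, its own included.\<close>

definition lookup :: "'s dtm list \<Rightarrow> nat \<Rightarrow> 's dtm" where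
  "lookup \<Gamma> n = rename (\<Gamma> ! n) (\<lambda>k. Suc (n + k))"

lemma lookup_0 [simp]: "lookup (A # \<Gamma>) 0 = rename A Suc"
  by (simp add: lookup_def)

lemma lookup_Suc [simp]: "lookup (A # \<Gamma>) (Suc n) = rename (lookup \<Gamma> n) Suc"
  by (simp add: lookup_def rename_rename)

text \<open>The fresh variable that opens a body in the named rules is index 0 here, so bodies are
  typed as they stand.\<close>

inductive dok :: "('s \<Rightarrow> 's \<Rightarrow> bool) \<Rightarrow> ('s \<Rightarrow> 's \<Rightarrow> 's \<Rightarrow> bool) \<Rightarrow> 's dtm list \<Rightarrow> bool"
  and dtyping :: "('s \<Rightarrow> 's \<Rightarrow> bool) \<Rightarrow> ('s \<Rightarrow> 's \<Rightarrow> 's \<Rightarrow> bool) \<Rightarrow> 's dtm list \<Rightarrow>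
    's dtm \<Rightarrow> 's dtm \<Rightarrow> bool"
  for Ax :: "'s \<Rightarrow> 's \<Rightarrow> bool" and Rl :: "'s \<Rightarrow> 's \<Rightarrow> 's \<Rightarrow> bool"
where
  dok_Nil: "dok Ax Rl []"
| dok_Cons: "dok Ax Rl \<Gamma> \<Longrightarrow> dtyping Ax Rl \<Gamma> A (DSort s) \<Longrightarrow> dok Ax Rl (A # \<Gamma>)"
| dty_sort: "dok Ax Rl \<Gamma> \<Longrightarrow> Ax s1 s2 \<Longrightarrow> dtyping Ax Rl \<Gamma> (DSort s1) (DSort s2)"
| dty_var: "dok Ax Rl \<Gamma> \<Longrightarrow> n < length \<Gamma> \<Longrightarrow> dtyping Ax Rl \<Gamma> (DVar n) (lookup \<Gamma> n)"
| dty_prod: "dtyping Ax Rl \<Gamma> A (DSort s1) \<Longrightarrow> dtyping Ax Rl (A # \<Gamma>) B (DSort s2) \<Longrightarrow>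
    Rl s1 s2 s3 \<Longrightarrow> dtyping Ax Rl \<Gamma> (DPi A B) (DSort s3)"
| dty_abs: "dtyping Ax Rl \<Gamma> A (DSort s1) \<Longrightarrow> dtyping Ax Rl (A # \<Gamma>) M B \<Longrightarrow>
    dtyping Ax Rl (A # \<Gamma>) B (DSort s2) \<Longrightarrow> Rl s1 s2 s3 \<Longrightarrow>
    dtyping Ax Rl \<Gamma> (DLam A M) (DPi A B)"
| dty_app: "dtyping Ax Rl \<Gamma> M (DPi A B) \<Longrightarrow> dtyping Ax Rl \<Gamma> N A \<Longrightarrow>
    dtyping Ax Rl \<Gamma> (DApp M N) (dsubst1 B N)"
| dty_conv: "dtyping Ax Rl \<Gamma> M A \<Longrightarrow> dtyping Ax Rl \<Gamma> B (DSort s) \<Longrightarrow> A \<simeq> B \<Longrightarrow>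
    dtyping Ax Rl \<Gamma> M B"

inductive_cases dok_ConsE: "dok Ax Rl (A # \<Gamma>)"

context
  fixes Ax :: "'s \<Rightarrow> 's \<Rightarrow> bool" and Rl :: "'s \<Rightarrow> 's \<Rightarrow> 's \<Rightarrow> bool"
begin

abbreviation wf_ctx ("\<turnstile> _" [50] 50) where "\<turnstile> \<Gamma> \<equiv> dok Ax Rl \<Gamma>"
abbreviation has_type ("_ \<turnstile> _ : _" [50, 50, 50] 50) where "\<Gamma> \<turnstile> M : A \<equiv> dtyping Ax Rl \<Gamma> M A"

section \<open>Stability of typing under renaming, substitution and context conversion\<close>

lemma typing_wf: "\<Gamma> \<turnstile> M : A \<Longrightarrow> \<turnstile> \<Gamma>"
  \<comment> \<open>The trivial predicate for \<open>dok\<close> turns the mutual induction into one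
    on typing derivations alone.\<close>
  by (induction rule: dok_dtyping.inducts(2)[where ?P1.0 = "\<lambda>_. True"]) auto

text \<open>Under a binder a weakening no longer acts at the head of the context, so the induction
  is over all renamings that respect the declared types.\<close>

lemma typing_rename:
  assumes "\<Gamma> \<turnstile> M : A" and "\<turnstile> \<Delta>"
    and "\<And>n. n < length \<Gamma> \<Longrightarrow> \<xi> n < length \<Delta> \<and> lookup \<Delta> (\<xi> n) = rename (lookup \<Gamma> n) \<xi>"
  shows "\<Delta> \<turnstile> rename M \<xi> : rename A \<xi>"
proof -
  have lift: "lift_ren \<zeta> n < length (rename A \<zeta> # \<Delta>) \<and>
      lookup (rename A \<zeta> # \<Delta>) (lift_ren \<zeta> n) = rename (lookup (A # \<Gamma>) n) (lift_ren \<zeta>)"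
    if "n < length (A # \<Gamma>)"
      and "\<And>n. n < length \<Gamma> \<Longrightarrow> \<zeta> n < length \<Delta> \<and> lookup \<Delta> (\<zeta> n) = rename (lookup \<Gamma> n) \<zeta>"
    for \<Gamma> \<Delta> :: "'s dtm list" and A \<zeta> n
    using that by (cases n) (auto simp: rename_rename)
  show ?thesis using assms
  proof (induction arbitrary: \<Delta> \<xi> rule: dok_dtyping.inducts(2)[where ?P1.0 = "\<lambda>_. True"])
    case (dty_var \<Gamma> n)
    then show ?case by (metis dok_dtyping.dty_var rename.simps(2))
  next
    case (dty_prod \<Gamma> A s1 B s2 s3)
    have A: "\<Delta> \<turnstile> rename A \<xi> : DSort s1" using dty_prod.IH(1)[OF dty_prod.prems] by simp
    then have ok: "\<turnstile> rename A \<xi> # \<Delta>" using dty_prod.prems(1) by (blast intro: dok_Cons)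
    have "rename A \<xi> # \<Delta> \<turnstile> rename B (lift_ren \<xi>) : DSort s2"
      using dty_prod.IH(2)[OF ok lift] dty_prod.prems(2) by simp
    with A dty_prod.hyps show ?case by (auto intro: dok_dtyping.dty_prod)
  next
    case (dty_abs \<Gamma> A s1 M B s2 s3)
    have A: "\<Delta> \<turnstile> rename A \<xi> : DSort s1" using dty_abs.IH(1)[OF dty_abs.prems] by simp
    then have ok: "\<turnstile> rename A \<xi> # \<Delta>" using dty_abs.prems(1) by (blast intro: dok_Cons)
    have "rename A \<xi> # \<Delta> \<turnstile> rename M (lift_ren \<xi>) : rename B (lift_ren \<xi>)"
      using dty_abs.IH(2)[OF ok lift] dty_abs.prems(2) by simp
    moreover have "rename A \<xi> # \<Delta> \<turnstile> rename B (lift_ren \<xi>) : DSort s2"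
      using dty_abs.IH(3)[OF ok lift] dty_abs.prems(2) by simp
    ultimately show ?case using A dty_abs.hyps by (auto intro: dok_dtyping.dty_abs)
  next
    case (dty_app \<Gamma> M A B N)
    from dty_app.IH(1)[OF dty_app.prems] dty_app.IH(2)[OF dty_app.prems]
    show ?case by (auto simp: rename_dsubst1 intro: dok_dtyping.dty_app)
  next
    case (dty_conv \<Gamma> M A B s)
    from dty_conv.IH(1)[OF dty_conv.prems] dty_conv.IH(2)[OF dty_conv.prems] dty_conv.hyps
    show ?case by (auto intro: dok_dtyping.dty_conv conv_rename)
  qed (auto intro: dty_sort)
qed

lemma typing_weaken: "\<Gamma> \<turnstile> M : A \<Longrightarrow> \<turnstile> B # \<Gamma> \<Longrightarrow> B # \<Gamma> \<turnstile> rename M Suc : rename A Suc"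
  by (erule typing_rename) auto

lemma typing_dsubst:
  assumes "\<Gamma> \<turnstile> M : A" and "\<turnstile> \<Delta>"
    and "\<And>n. n < length \<Gamma> \<Longrightarrow> \<Delta> \<turnstile> \<sigma> n : dsubst (lookup \<Gamma> n) \<sigma>"
  shows "\<Delta> \<turnstile> dsubst M \<sigma> : dsubst A \<sigma>"
proof -
  \<comment> \<open>Under a binder, index 0 has its declared type and the other images are
    weakened.\<close>
  have lift: "dsubst A \<tau> # \<Delta> \<turnstile> lift_sub \<tau> n : dsubst (lookup (A # \<Gamma>) n) (lift_sub \<tau>)"
    if ok: "\<turnstile> dsubst A \<tau> # \<Delta>" and n: "n < length (A # \<Gamma>)"
      and \<tau>: "\<And>n. n < length \<Gamma> \<Longrightarrow> \<Delta> \<turnstile> \<tau> n : dsubst (lookup \<Gamma> n) \<tau>"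
    for \<Gamma> \<Delta> :: "'s dtm list" and A \<tau> n
  proof (cases n)
    case 0
    then show ?thesis using dty_var[OF ok, of 0] by (simp add: dsubst_rename rename_dsubst)
  next
    case (Suc m)
    then show ?thesis using typing_weaken[OF \<tau> ok, of m] n
      by (simp add: dsubst_rename rename_dsubst)
  qed
  show ?thesis using assms
  proof (induction arbitrary: \<Delta> \<sigma> rule: dok_dtyping.inducts(2)[where ?P1.0 = "\<lambda>_. True"])
    case (dty_prod \<Gamma> A s1 B s2 s3)
    have A: "\<Delta> \<turnstile> dsubst A \<sigma> : DSort s1" using dty_prod.IH(1)[OF dty_prod.prems] by simp
    then have ok: "\<turnstile> dsubst A \<sigma> # \<Delta>" using dty_prod.prems(1) by (blast intro: dok_Cons)
    have "dsubst A \<sigma> # \<Delta> \<turnstile> dsubst B (lift_sub \<sigma>) : DSort s2"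
      using dty_prod.IH(2)[OF ok lift[OF ok]] dty_prod.prems(2) by simp
    with A dty_prod.hyps show ?case by (auto intro: dok_dtyping.dty_prod)
  next
    case (dty_abs \<Gamma> A s1 M B s2 s3)
    have A: "\<Delta> \<turnstile> dsubst A \<sigma> : DSort s1" using dty_abs.IH(1)[OF dty_abs.prems] by simp
    then have ok: "\<turnstile> dsubst A \<sigma> # \<Delta>" using dty_abs.prems(1) by (blast intro: dok_Cons)
    have "dsubst A \<sigma> # \<Delta> \<turnstile> dsubst M (lift_sub \<sigma>) : dsubst B (lift_sub \<sigma>)"
      using dty_abs.IH(2)[OF ok lift[OF ok]] dty_abs.prems(2) by simp
    moreover have "dsubst A \<sigma> # \<Delta> \<turnstile> dsubst B (lift_sub \<sigma>) : DSort s2"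
      using dty_abs.IH(3)[OF ok lift[OF ok]] dty_abs.prems(2) by simp
    ultimately show ?case using A dty_abs.hyps by (auto intro: dok_dtyping.dty_abs)
  next
    case (dty_app \<Gamma> M A B N)
    from dty_app.IH(1)[OF dty_app.prems] dty_app.IH(2)[OF dty_app.prems]
    show ?case by (auto simp: dsubst_dsubst1 intro: dok_dtyping.dty_app)
  next
    case (dty_conv \<Gamma> M A B s)
    from dty_conv.IH(1)[OF dty_conv.prems] dty_conv.IH(2)[OF dty_conv.prems] dty_conv.hyps
    show ?case by (auto intro: dok_dtyping.dty_conv conv_dsubst)
  qed (auto intro: dty_sort)
qed

lemma typing_dsubst1:
  assumes "A # \<Gamma> \<turnstile> M : B" and "\<Gamma> \<turnstile> N : A"
  shows "\<Gamma> \<turnstile> dsubst1 M N : dsubst1 B N"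
  unfolding dsubst1_def
proof (rule typing_dsubst[OF assms(1) typing_wf[OF assms(2)]])
  fix n assume "n < length (A # \<Gamma>)"
  then show "\<Gamma> \<turnstile> case_nat N DVar n : dsubst (lookup (A # \<Gamma>) n) (case_nat N DVar)"
    using assms(2) typing_wf[OF assms(2)]
    by (cases n) (auto simp: dsubst_rename intro: dty_var)
qed

text \<open>The identity is a well-typed substitution between the two contexts, because conversion
  gives index 0 its old type.\<close>

lemma typing_ctx_conv:
  assumes M: "A # \<Gamma> \<turnstile> M : B" and A': "\<Gamma> \<turnstile> A' : DSort s" and "A \<simeq> A'"
  shows "A' # \<Gamma> \<turnstile> M : B"
proof -
  have ok: "\<turnstile> A' # \<Gamma>" using A' typing_wf by (blast intro: dok_Cons)
  \<comment> \<open>The conversion rule asks for a sort typing the old \<open>A\<close>;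
    well-formedness of \<open>A # \<Gamma>\<close> supplies it.\<close>
  obtain s' where "\<Gamma> \<turnstile> A : DSort s'" using typing_wf[OF M] by (auto elim: dok_ConsE)
  from typing_weaken[OF this ok] have "A' # \<Gamma> \<turnstile> rename A Suc : DSort s'" by simp
  then have "A' # \<Gamma> \<turnstile> DVar 0 : rename A Suc"
    using dty_var[OF ok, of 0] \<open>A \<simeq> A'\<close>
    by (auto intro: dty_conv equivclp_sym conv_rename)
  moreover have "A' # \<Gamma> \<turnstile> DVar (Suc n) : lookup (A # \<Gamma>) (Suc n)" if "n < length \<Gamma>" for n
    using dty_var[OF ok, of "Suc n"] that by simp
  ultimately have "A' # \<Gamma> \<turnstile> dsubst M DVar : dsubst B DVar"
    by (intro typing_dsubst[OF M ok]) (case_tac n, auto)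
  then show ?thesis by simp
qed

section \<open>Inversion of typing derivations\<close>

lemma typing_SortE:
  assumes "\<Gamma> \<turnstile> DSort s : T"
  obtains s' where "DSort s' \<simeq> T"
proof -
  have "\<exists>s'. DSort s' \<simeq> T"
    using assms
    \<comment> \<open>Uses of the conversion rule after the structural rule are absorbed by
      transitivity of \<simeq>.\<close>
    by (induction \<Gamma> "DSort s" T rule: dok_dtyping.inducts(2)[where ?P1.0 = "\<lambda>_. True"])
      (auto intro: equivclp_trans)
  with that show thesis by blast
qed

lemma typing_VarE:
  assumes "\<Gamma> \<turnstile> DVar n : T"
  obtains "n < length \<Gamma>" "lookup \<Gamma> n \<simeq> T"
proof -
  have "n < length \<Gamma> \<and> lookup \<Gamma> n \<simeq> T"
    using assms
    by (induction \<Gamma> "DVar n :: 's dtm" T rule: dok_dtyping.inducts(2)[where ?P1.0 = "\<lambda>_. True"])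
      (auto intro: equivclp_trans)
  with that show thesis by blast
qed

lemma typing_PiE:
  assumes "\<Gamma> \<turnstile> DPi A B : T"
  obtains s1 s2 s3 where "\<Gamma> \<turnstile> A : DSort s1" "A # \<Gamma> \<turnstile> B : DSort s2" "DSort s3 \<simeq> T"
proof -
  have "\<exists>s1 s2 s3. (\<Gamma> \<turnstile> A : DSort s1) \<and> (A # \<Gamma> \<turnstile> B : DSort s2) \<and> DSort s3 \<simeq> T"
    using assms
    by (induction \<Gamma> "DPi A B" T rule: dok_dtyping.inducts(2)[where ?P1.0 = "\<lambda>_. True"])
      (blast intro: equivclp_trans equivclp_refl)+
  with that show thesis by blast
qed

lemma typing_LamE:
  assumes "\<Gamma> \<turnstile> DLam A M : T"
  obtains B s1 s2 where "\<Gamma> \<turnstile> A : DSort s1" "A # \<Gamma> \<turnstile> M : B" "A # \<Gamma> \<turnstile> B : DSort s2"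
    "DPi A B \<simeq> T"
proof -
  have "\<exists>B s1 s2. (\<Gamma> \<turnstile> A : DSort s1) \<and> (A # \<Gamma> \<turnstile> M : B) \<and> (A # \<Gamma> \<turnstile> B : DSort s2) \<and>
      DPi A B \<simeq> T"
    using assms
    by (induction \<Gamma> "DLam A M" T rule: dok_dtyping.inducts(2)[where ?P1.0 = "\<lambda>_. True"])
      (blast intro: equivclp_trans equivclp_refl)+
  with that show thesis by blast
qed

lemma typing_AppE:
  assumes "\<Gamma> \<turnstile> DApp M N : T"
  obtains A B where "\<Gamma> \<turnstile> M : DPi A B"
proof -
  have "\<exists>A B. \<Gamma> \<turnstile> M : DPi A B"
    using assms
    by (induction \<Gamma> "DApp M N" T rule: dok_dtyping.inducts(2)[where ?P1.0 = "\<lambda>_. True"]) blast+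
  with that show thesis by blast
qed

section \<open>Validity of types and subject reduction\<close>

lemma lookup_typed: "\<turnstile> \<Gamma> \<Longrightarrow> n < length \<Gamma> \<Longrightarrow> \<exists>s. \<Gamma> \<turnstile> lookup \<Gamma> n : DSort s"
proof (induction \<Gamma> arbitrary: n)
  case (Cons A \<Gamma>)
  then obtain s where "\<turnstile> \<Gamma>" "\<Gamma> \<turnstile> A : DSort s" by (auto elim: dok_ConsE)
  \<comment> \<open>Before the last shift, the type of index \<open>n\<close> is \<open>A\<close> or
    comes from the tail, so one weakening serves both cases.\<close>
  then have "\<exists>s. \<Gamma> \<turnstile> (case n of 0 \<Rightarrow> A | Suc m \<Rightarrow> lookup \<Gamma> m) : DSort s"
    using Cons by (cases n) auto
  then obtain s where "\<Gamma> \<turnstile> (case n of 0 \<Rightarrow> A | Suc m \<Rightarrow> lookup \<Gamma> m) : DSort s" ..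
  from typing_weaken[OF this Cons.prems(1)] show ?case by (cases n) auto
qed simp

text \<open>The first alternative covers sorts that themselves have no type. For an application,
  inverting the typing of the product types \<open>B\<close>, which is then instantiated.\<close>

lemma type_validity: "\<Gamma> \<turnstile> M : A \<Longrightarrow> (\<exists>s. A = DSort s) \<or> (\<exists>s. \<Gamma> \<turnstile> A : DSort s)"
proof (induction rule: dok_dtyping.inducts(2)[where ?P1.0 = "\<lambda>_. True"])
  case (dty_app \<Gamma> M A B N)
  then obtain s where "A # \<Gamma> \<turnstile> B : DSort s" by (auto elim: typing_PiE)
  from typing_dsubst1[OF this dty_app.hyps(2)] show ?case by (auto simp: dsubst1_def)
qed (auto intro: lookup_typed dty_prod)

text \<open>In the abstraction and application cases the reduct is first given a type changed by the
  step, then converted back; the conversion rule requires the original type to be typed.\<close>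

theorem subject_reduction: "\<Gamma> \<turnstile> M : A \<Longrightarrow> M \<Rrightarrow> M' \<Longrightarrow> \<Gamma> \<turnstile> M' : A"
proof (induction arbitrary: M' rule: dok_dtyping.inducts(2)[where ?P1.0 = "\<lambda>_. True"])
  case (dty_prod \<Gamma> A s1 B s2 s3)
  from dty_prod.prems obtain A' B' where "M' = DPi A' B'" "A \<Rrightarrow> A'" "B \<Rrightarrow> B'" by auto
  with dty_prod show ?case
    by (meson dok_dtyping.dty_prod typing_ctx_conv r_into_equivclp)
next
  case (dty_abs \<Gamma> A s1 N B s2 s3)
  from dty_abs.prems obtain A' N' where M': "M' = DLam A' N'" "A \<Rrightarrow> A'" "N \<Rrightarrow> N'" by auto
  have A': "\<Gamma> \<turnstile> A' : DSort s1" using dty_abs.IH(1) M' by blast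
  have "A' # \<Gamma> \<turnstile> N' : B" "A' # \<Gamma> \<turnstile> B : DSort s2"
    using dty_abs.IH(2) dty_abs.hyps(3) M' A' by (meson typing_ctx_conv r_into_equivclp)+
  then have "\<Gamma> \<turnstile> M' : DPi A' B" using A' dty_abs.hyps M' by (auto intro: dok_dtyping.dty_abs)
  moreover have "\<Gamma> \<turnstile> DPi A B : DSort s3" using dty_abs.hyps by (auto intro: dok_dtyping.dty_prod)
  moreover have "DPi A' B \<simeq> DPi A B" using M' by blast
  ultimately show ?case by (rule dty_conv)
next
  case (dty_app \<Gamma> M A B N)
  from type_validity[OF dty_app.hyps(1)] obtain s where B: "A # \<Gamma> \<turnstile> B : DSort s"
    by (auto elim: typing_PiE)
  from typing_dsubst1[OF B dty_app.hyps(2)]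
  have BN: "\<Gamma> \<turnstile> dsubst1 B N : DSort s" by (simp add: dsubst1_def)
  have conv: "dsubst1 B N' \<simeq> dsubst1 B N" if "N \<Rrightarrow> N'" for N'
    using that by (blast intro: par_dsubst1)
  from dty_app.prems consider
      (app) P N' where "M' = DApp P N'" "M \<Rrightarrow> P" "N \<Rrightarrow> N'"
    | (beta) C P P' N' where "M = DLam C P" "M' = dsubst1 P' N'" "P \<Rrightarrow> P'" "N \<Rrightarrow> N'"
    by (auto elim: par_AppE)
  then show ?case
  proof cases
    case app
    then have "\<Gamma> \<turnstile> M' : dsubst1 B N'" using dty_app.IH by (auto intro: dok_dtyping.dty_app)
    then show ?thesis using BN conv app by (blast intro: dty_conv)
  next
    case beta
    \<comment> \<open>The induction hypothesis is applied to the step that reduces only the body,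
      using \<open>C \<Rrightarrow> C\<close>.\<close>
    then have "\<Gamma> \<turnstile> DLam C P' : DPi A B" using dty_app.IH(1) beta by blast
    then obtain D s1 s2 where D: "\<Gamma> \<turnstile> C : DSort s1" "C # \<Gamma> \<turnstile> P' : D" "DPi C D \<simeq> DPi A B"
      by (auto elim: typing_LamE)
    \<comment> \<open>Injectivity of products, a consequence of confluence, lets the argument be
      retyped at the domain \<open>C\<close> of the abstraction.\<close>
    then have "C \<simeq> A" "D \<simeq> B" by (auto dest: conv_PiD)
    moreover have "\<Gamma> \<turnstile> N' : A" using dty_app.IH(2) beta by blast
    ultimately have "\<Gamma> \<turnstile> N' : C" using D(1) by (blast intro: dty_conv equivclp_sym)
    then have "\<Gamma> \<turnstile> dsubst1 P' N' : dsubst1 D N'" using D(2) by (blast intro: typing_dsubst1)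
    moreover have "dsubst1 D N' \<simeq> dsubst1 B N"
      using conv_dsubst1[OF \<open>D \<simeq> B\<close>] conv beta by (blast intro: equivclp_trans)
    ultimately show ?thesis using BN beta by (blast intro: dty_conv)
  qed
qed (auto intro: dty_sort dty_var dty_conv)

lemma subject_reduction_rtrancl: "par\<^sup>*\<^sup>* M M' \<Longrightarrow> \<Gamma> \<turnstile> M : A \<Longrightarrow> \<Gamma> \<turnstile> M' : A"
  by (induction rule: rtranclp_induct) (auto intro: subject_reduction)

section \<open>Normal terms\<close>

text \<open>No term is irreducible for the reflexive relation \<open>\<Rrightarrow>\<close>, so
  absence of redexes is read off the syntax.\<close>

primrec normal :: "'s dtm \<Rightarrow> bool" where
  "normal (DSort s) = True"
| "normal (DVar n) = True"
| "normal (DLam A M) = (normal A \<and> normal M)"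
| "normal (DPi A M) = (normal A \<and> normal M)"
| "normal (DApp M N) = (normal M \<and> normal N \<and> (\<nexists>A P. M = DLam A P))"

text \<open>Sorts, products and, by the assumption on the context, variables only have types
  convertible to sorts, never to products.\<close>

lemma normal_Pi_Lam:
  assumes "\<And>n. n < length \<Gamma> \<Longrightarrow> \<exists>s. lookup \<Gamma> n \<simeq> DSort s"
    and "normal M" and "\<Gamma> \<turnstile> M : DPi A B"
  shows "\<exists>C P. M = DLam C P"
  using assms(2,3)
proof (induction M arbitrary: A B)
  case (DVar n)
  then show ?case using assms(1) by (metis typing_VarE equivclp_sym equivclp_trans conv_Sort_Pi)
next
  \<comment> \<open>By induction \<open>P\<close> would be an abstraction, making
    \<open>DApp P Q\<close> a redex.\<close>
  case (DApp P Q)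
  then show ?case by (metis typing_AppE normal.simps(5))
qed (auto elim: typing_SortE typing_PiE typing_AppE simp: conv_Sort_Pi)

text \<open>The outermost constructor decides: an abstraction has a type convertible to a product,
  an application is excluded by \<open>normal_Pi_Lam\<close>, and every other term has a type
  convertible to a sort.\<close>

lemma normal_type_not_Var:
  assumes sorts: "\<And>n. n < length \<Gamma> \<Longrightarrow> \<exists>s. lookup \<Gamma> n \<simeq> DSort s"
    and "normal M" and "\<Gamma> \<turnstile> M : A"
  shows "\<not> A \<simeq> DVar k"
proof
  assume A: "A \<simeq> DVar k"
  show False
  proof (cases M)
    case (DVar n)
    with assms(3) have "n < length \<Gamma>" "lookup \<Gamma> n \<simeq> A" by (auto elim: typing_VarE)
    moreover from this sorts obtain s where "lookup \<Gamma> n \<simeq> DSort s" by blast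
    ultimately have "DSort s \<simeq> DVar k" using A by (blast intro: equivclp_sym equivclp_trans)
    then show False by (simp add: conv_Sort_Var)
  next
    case (DApp P Q)
    with assms(3) obtain B C where "\<Gamma> \<turnstile> P : DPi B C" by (auto elim: typing_AppE)
    then show False using normal_Pi_Lam[OF sorts, of P B C] \<open>normal M\<close> DApp by auto
  next
    case (DSort s)
    then obtain s' where "DSort s' \<simeq> A" using assms(3) by (auto elim: typing_SortE)
    from equivclp_trans[OF this A] show False by (simp add: conv_Sort_Var)
  next
    case (DLam B P)
    then obtain C where "DPi B C \<simeq> A" using assms(3) by (auto elim: typing_LamE)
    from equivclp_trans[OF this A] show False by (simp add: conv_Pi_Var)
  next
    case (DPi B C)
    then obtain s' where "DSort s' \<simeq> A" using assms(3) by (auto elim: typing_PiE)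
    from equivclp_trans[OF this A] show False by (simp add: conv_Sort_Var)
  qed
qed

lemma no_normal_inhabitant:
  assumes "normal M" and M: "[] \<turnstile> M : DPi (DSort s) (DVar 0)"
  shows False
proof -
  \<comment> \<open>For the empty context the assumption on declared types holds vacuously.\<close>
  obtain A P where P: "M = DLam A P" using normal_Pi_Lam[OF _ assms] by auto
  with M obtain B where B: "[A] \<turnstile> P : B" "DPi A B \<simeq> DPi (DSort s) (DVar 0)"
    by (auto elim: typing_LamE)
  then have "A \<simeq> DSort s" "B \<simeq> DVar 0" by (auto dest: conv_PiD)
  \<comment> \<open>In \<open>[A]\<close> the looked-up type is \<open>A\<close> shifted by
    \<open>Suc\<close>, a shift that leaves the sort fixed.\<close>
  from conv_rename[OF this(1), of Suc]
  have "\<exists>s. lookup [A] n \<simeq> DSort s" if "n < length [A]" for n using that by auto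
  from normal_type_not_Var[OF this _ B(1)] \<open>normal M\<close> \<open>B \<simeq> DVar 0\<close> show False
    by (simp add: P)
qed

end

section \<open>Interpretation of named terms\<close>

text \<open>The environment inside a binder for \<open>x\<close>, which shadows an outer
  \<open>x\<close>.\<close>

definition extend :: "('v \<Rightarrow> nat) \<Rightarrow> 'v \<Rightarrow> 'v \<Rightarrow> nat" where
  "extend f x = (\<lambda>z. if z = x then 0 else Suc (f z))"

lemma extend_simps [simp]:
  "extend f x x = 0" "z \<noteq> x \<Longrightarrow> extend f x z = Suc (f z)"
  by (simp_all add: extend_def)

primrec debruijn :: "('v \<Rightarrow> nat) \<Rightarrow> ('s, 'v) tm \<Rightarrow> 's dtm" where
  "debruijn f (Sort s) = DSort s"
| "debruijn f (Var x) = DVar (f x)"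
| "debruijn f (Lam x A M) = DLam (debruijn f A) (debruijn (extend f x) M)"
| "debruijn f (Pi x A M) = DPi (debruijn f A) (debruijn (extend f x) M)"
| "debruijn f (App M N) = DApp (debruijn f M) (debruijn f N)"

section \<open>Named substitution under the interpretation\<close>

lemma fresh_var_fresh:
  assumes "y \<in> set xs"
  shows "fresh_var \<sigma> xs \<notin> set (fv (\<sigma> y))"
proof -
  let ?V = "\<Union>y\<in>set xs. set (fv (\<sigma> y))"
  \<comment> \<open>Only finitely many variables are excluded, so \<open>LEAST\<close> has a
    witness.\<close>
  have "infinite (range (var_enum :: nat \<Rightarrow> 'a))"
    using bij_var_enum bij_is_inj finite_imageD infinite_UNIV_nat by blast
  then obtain n where "var_enum n \<notin> ?V"
    by (metis finite_UN_I finite_set infinite_super image_subsetI)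
  then have "\<forall>y\<in>set xs. var_enum n \<notin> set (fv (\<sigma> y))" by blast
  from LeastI[of "\<lambda>n. \<forall>y\<in>set xs. var_enum n \<notin> set (fv (\<sigma> y))", OF this]
  show ?thesis using assms by (simp add: fresh_var_def)
qed

text \<open>The chosen bound variable is fresh for the images of the free variables, hence captures
  none of them. \<open>typing_fv\<close> uses this to pass from an opened body back to the
  body.\<close>

lemma fv_subst: "z \<in> set (fv M) \<Longrightarrow> w \<in> set (fv (\<sigma> z)) \<Longrightarrow> w \<in> set (fv (M \<bullet> \<sigma>))"
proof (induction M arbitrary: \<sigma>)
  case (Lam x A M)
  have "w \<noteq> fresh_var \<sigma> (removeAll x (fv M))" if "z \<in> set (fv M)" "z \<noteq> x"
    using fresh_var_fresh[of z "removeAll x (fv M)" \<sigma>] that Lam.prems(2) by auto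
  then show ?case using Lam by (auto simp: Let_def)
next
  case (Pi x A M)
  have "w \<noteq> fresh_var \<sigma> (removeAll x (fv M))" if "z \<in> set (fv M)" "z \<noteq> x"
    using fresh_var_fresh[of z "removeAll x (fv M)" \<sigma>] that Pi.prems(2) by auto
  then show ?case using Pi by (auto simp: Let_def)
qed auto

lemma fv_subst1: "z \<in> set (fv M) \<Longrightarrow> z \<noteq> x \<Longrightarrow> z \<in> set (fv (M[x ::= N]))"
  unfolding subst1_def by (rule fv_subst) auto

lemma debruijn_rename:
  "(\<And>z. z \<in> set (fv M) \<Longrightarrow> g z = \<xi> (f z)) \<Longrightarrow> debruijn g M = rename (debruijn f M) \<xi>"
proof (induction M arbitrary: f g \<xi>)
  case (Lam x A M)
  have "debruijn g A = rename (debruijn f A) \<xi>" using Lam.prems by (intro Lam.IH(1)) auto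
  moreover have "debruijn (extend g x) M = rename (debruijn (extend f x) M) (lift_ren \<xi>)"
    using Lam.prems by (intro Lam.IH(2)) (auto simp: extend_def)
  ultimately show ?case by simp
next
  case (Pi x A M)
  have "debruijn g A = rename (debruijn f A) \<xi>" using Pi.prems by (intro Pi.IH(1)) auto
  moreover have "debruijn (extend g x) M = rename (debruijn (extend f x) M) (lift_ren \<xi>)"
    using Pi.prems by (intro Pi.IH(2)) (auto simp: extend_def)
  ultimately show ?case by simp
next
  case (App M N)
  have "debruijn g M = rename (debruijn f M) \<xi>" using App.prems by (intro App.IH(1)) auto
  moreover have "debruijn g N = rename (debruijn f N) \<xi>" using App.prems by (intro App.IH(2)) auto
  ultimately show ?case by simp
qed auto

lemma debruijn_extend:
  "y \<notin> set (fv M) \<Longrightarrow> debruijn (extend f y) M = rename (debruijn f M) Suc"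
  by (rule debruijn_rename) (auto simp: extend_def)

text \<open>The bound variable is chosen fresh only for images of variables free in the body, so the
  hypothesis relating \<open>\<sigma>\<close> and \<open>\<tau>\<close> is restricted in the same
  way.\<close>

lemma debruijn_subst:
  "(\<And>z. z \<in> set (fv M) \<Longrightarrow> debruijn f (\<sigma> z) = \<tau> (g z)) \<Longrightarrow>
    debruijn f (M \<bullet> \<sigma>) = dsubst (debruijn g M) \<tau>"
proof (induction M arbitrary: f g \<sigma> \<tau>)
  case (Lam x A M)
  let ?y = "fresh_var \<sigma> (removeAll x (fv M))"
  \<comment> \<open>For \<open>z\<close> other than \<open>x\<close>, \<open>?y\<close> is not free
    in \<open>\<sigma> z\<close>; entering its binder only shifts the image, as
    \<open>lift_sub\<close> does.\<close>
  have body: "debruijn (extend f ?y) ((\<sigma>(x := Var ?y)) z) = lift_sub \<tau> (extend g x z)"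
    if "z \<in> set (fv M)" for z
    using that Lam.prems[of z] fresh_var_fresh[of z "removeAll x (fv M)" \<sigma>]
    by (cases "z = x") (auto simp: debruijn_extend)
  have "debruijn f (A \<bullet> \<sigma>) = dsubst (debruijn g A) \<tau>" using Lam.prems by (intro Lam.IH(1)) auto
  moreover have "debruijn (extend f ?y) (M \<bullet> \<sigma>(x := Var ?y)) =
      dsubst (debruijn (extend g x) M) (lift_sub \<tau>)"
    by (rule Lam.IH(2)) (rule body)
  ultimately show ?case by (simp add: Let_def)
next
  case (Pi x A M)
  let ?y = "fresh_var \<sigma> (removeAll x (fv M))"
  have body: "debruijn (extend f ?y) ((\<sigma>(x := Var ?y)) z) = lift_sub \<tau> (extend g x z)"
    if "z \<in> set (fv M)" for z
    using that Pi.prems[of z] fresh_var_fresh[of z "removeAll x (fv M)" \<sigma>]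
    by (cases "z = x") (auto simp: debruijn_extend)
  have "debruijn f (A \<bullet> \<sigma>) = dsubst (debruijn g A) \<tau>" using Pi.prems by (intro Pi.IH(1)) auto
  moreover have "debruijn (extend f ?y) (M \<bullet> \<sigma>(x := Var ?y)) =
      dsubst (debruijn (extend g x) M) (lift_sub \<tau>)"
    by (rule Pi.IH(2)) (rule body)
  ultimately show ?case by (simp add: Let_def)
next
  case (App M N)
  have "debruijn f (M \<bullet> \<sigma>) = dsubst (debruijn g M) \<tau>" using App.prems by (intro App.IH(1)) auto
  moreover have "debruijn f (N \<bullet> \<sigma>) = dsubst (debruijn g N) \<tau>"
    using App.prems by (intro App.IH(2)) auto
  ultimately show ?case by simp
qed auto

lemma debruijn_subst1:
  "debruijn f (M[x ::= N]) = dsubst1 (debruijn (extend f x) M) (debruijn f N)"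
  unfolding subst1_def dsubst1_def by (rule debruijn_subst) (auto simp: extend_def)

text \<open>Changing the bound name amounts to the identity substitution. This accounts both for
  \<alpha>-conversion and for the opened bodies in the typing rules.\<close>

lemma debruijn_change_bound:
  assumes "y \<notin> set (removeAll x (fv M))"
  shows "debruijn (extend f y) (M[x ::= Var y]) = debruijn (extend f x) M"
proof -
  have "debruijn (extend f y) (M[x ::= Var y]) = dsubst (debruijn (extend f x) M) DVar"
    unfolding subst1_def using assms by (intro debruijn_subst) (auto simp: extend_def)
  then show ?thesis by simp
qed

section \<open>Conversion, reduction and normal forms under the interpretation\<close>

lemma debruijn_alpha: "M \<sim>\<^sub>\<alpha> N \<Longrightarrow> debruijn f M = debruijn f N"
proof (induction arbitrary: f rule: alpha.induct)
  case (alpha_Lam A A' y x M x' M')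
  then show ?case using debruijn_change_bound[of y x M f] debruijn_change_bound[of y x' M' f]
    by simp
next
  case (alpha_Pi A A' y x M x' M')
  then show ?case using debruijn_change_bound[of y x M f] debruijn_change_bound[of y x' M' f]
    by simp
qed auto

lemma debruijn_beta: "M \<rightarrow>\<^sub>\<beta> N \<Longrightarrow> debruijn f M \<Rrightarrow> debruijn f N"
  by (induction arbitrary: f rule: beta.induct) (auto simp: debruijn_subst1)

lemma debruijn_beta_reds: "M \<rightarrow>\<^sub>\<beta>\<^sup>* N \<Longrightarrow> par\<^sup>*\<^sup>* (debruijn f M) (debruijn f N)"
  by (induction rule: rtranclp_induct) (auto intro: rtranclp.rtrancl_into_rtrancl debruijn_beta)

lemma debruijn_beta_conv: "M \<simeq>\<^sub>\<beta> N \<Longrightarrow> debruijn f M \<simeq> debruijn f N"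
proof (induction rule: equivclp_induct)
  case (step P Q)
  then have "debruijn f P \<simeq> debruijn f Q"
    by (auto simp: debruijn_alpha dest: debruijn_beta)
  with step show ?case by (blast intro: equivclp_trans)
qed simp

lemma debruijn_eq_Lam: "debruijn f M = DLam A P \<Longrightarrow> \<exists>x B Q. M = Lam x B Q"
  by (cases M) auto

lemma nf_LamD: "nf (Lam x A M) \<Longrightarrow> nf A \<and> nf M"
  unfolding nf_def by (metis beta_LamL beta_LamR)

lemma nf_PiD: "nf (Pi x A M) \<Longrightarrow> nf A \<and> nf M"
  unfolding nf_def by (metis beta_PiL beta_PiR)

lemma nf_AppD: "nf (App M N) \<Longrightarrow> nf M \<and> nf N \<and> (\<nexists>x A P. M = Lam x A P)"
  unfolding nf_def by (metis beta_AppL beta_AppR beta_redex)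

text \<open>Head constructors are preserved, so a redex in the image would come from a redex in
  \<open>M\<close>.\<close>

lemma normal_debruijn: "nf M \<Longrightarrow> normal (debruijn f M)"
  by (induction M arbitrary: f)
    (auto dest!: nf_LamD nf_PiD nf_AppD debruijn_eq_Lam)

section \<open>Interpretation of contexts and derivations\<close>

text \<open>Starting from 0, an undeclared variable ends up at \<open>length \<Gamma>\<close>, just
  outside the context.\<close>

primrec index :: "('s, 'v) ctx \<Rightarrow> 'v \<Rightarrow> nat" where
  "index [] = (\<lambda>_. 0)"
| "index (d # \<Gamma>) = extend (index \<Gamma>) (fst d)"

primrec debruijn_ctx :: "('s, 'v) ctx \<Rightarrow> 's dtm list" where
  "debruijn_ctx [] = []"
| "debruijn_ctx (d # \<Gamma>) = debruijn (index \<Gamma>) (snd d) # debruijn_ctx \<Gamma>"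

lemma length_debruijn_ctx [simp]: "length (debruijn_ctx \<Gamma>) = length \<Gamma>"
  by (induction \<Gamma>) auto

text \<open>For products and abstractions, free variables of the body survive in the opened body,
  and the side condition rules out the fresh variable among them.\<close>

lemma typing_fv: "typing Ax Rl \<Gamma> M A \<Longrightarrow> set (fv M) \<subseteq> set (map fst \<Gamma>)"
proof (induction rule: ok_typing.inducts(2)[where ?P1.0 = "\<lambda>_. True"])
  case (ty_prod \<Gamma> A s1 y B x s2 s3)
  then show ?case using fv_subst1[of _ B x "Var y"] by auto
next
  case (ty_abs \<Gamma> A s1 z M x B y s2 s3)
  then show ?case using fv_subst1[of _ M x "Var z"] by auto
next
  case (ty_var \<Gamma> x A)
  then show ?case by force
qed auto

inductive_cases ok_ConsE: "ok Ax Rl (d # \<Gamma>)"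

text \<open>The bound on \<open>fv A\<close> strengthens the induction: a newly declared variable is
  then not free in older types, whose interpretation is merely shifted.\<close>

lemma lookup_debruijn_ctx:
  "ok Ax Rl \<Gamma> \<Longrightarrow> (x, A) \<in> set \<Gamma> \<Longrightarrow>
    index \<Gamma> x < length \<Gamma> \<and> set (fv A) \<subseteq> set (map fst \<Gamma>) \<and>
    lookup (debruijn_ctx \<Gamma>) (index \<Gamma> x) = debruijn (index \<Gamma>) A"
proof (induction \<Gamma>)
  case (Cons d \<Gamma>)
  from Cons.prems(1) obtain y B s where d: "d = (y, B)" "ok Ax Rl \<Gamma>" "typing Ax Rl \<Gamma> B (Sort s)"
    "y \<notin> set (map fst \<Gamma>)"
    by (auto elim: ok_ConsE)
  show ?case
  proof (cases "(x, A) = d")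
    case True
    moreover have "y \<notin> set (fv B)" using d(4) typing_fv[OF d(3)] by blast
    ultimately show ?thesis using d(1) typing_fv[OF d(3)] by (auto simp: debruijn_extend)
  next
    case False
    with Cons.prems have A: "(x, A) \<in> set \<Gamma>" by auto
    then have "x \<noteq> y" using d(4) by force
    moreover have "y \<notin> set (fv A)" using Cons.IH[OF d(2) A] d(4) by blast
    ultimately show ?thesis using Cons.IH[OF d(2) A] d(1)
      by (auto simp: debruijn_extend)
  qed
qed simp

lemma debruijn_typing:
  "ok Ax Rl \<Gamma> \<Longrightarrow> dok Ax Rl (debruijn_ctx \<Gamma>)"
  "typing Ax Rl \<Gamma> M A \<Longrightarrow>
    dtyping Ax Rl (debruijn_ctx \<Gamma>) (debruijn (index \<Gamma>) M) (debruijn (index \<Gamma>) A)"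
proof (induction rule: ok_typing.inducts)
  case (ty_var \<Gamma> x A)
  from lookup_debruijn_ctx[OF this(1,3)] dty_var[OF this(2), of "index \<Gamma> x"]
  show ?case by simp
next
  case (ty_prod \<Gamma> A s1 y B x s2 s3)
  \<comment> \<open>The context extended by \<open>y\<close> has environment
    \<open>extend (index \<Gamma>) y\<close>, where the opened body means the same as
    \<open>B\<close> under its own binder.\<close>
  then show ?case by (simp add: debruijn_change_bound) (rule dty_prod)
next
  case (ty_abs \<Gamma> A s1 z M x B y s2 s3)
  then show ?case by (simp add: debruijn_change_bound) (rule dty_abs)
next
  case (ty_app \<Gamma> M x A B N)
  then show ?case by (simp add: debruijn_subst1) (rule dty_app)
next
  case (ty_conv \<Gamma> M A B s)
  from ty_conv(2) ty_conv(4)[simplified] debruijn_beta_conv[OF ty_conv.hyps]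
  show ?case by (rule dty_conv)
qed (auto intro: dok_Nil dok_Cons dty_sort)

theorem theorem3:
  fixes Ax :: "'s \<Rightarrow> 's \<Rightarrow> bool" and Rl :: "'s \<Rightarrow> 's \<Rightarrow> 's \<Rightarrow> bool"
    and x :: "'v::variable" and s :: 's
  assumes "normalizing TYPE('v) Ax Rl"
  shows "\<nexists>M. typing Ax Rl [] M (Pi x (Sort s) (Var x))"
proof
  assume "\<exists>M. typing Ax Rl [] M (Pi x (Sort s) (Var x))"
  then obtain M where M: "typing Ax Rl [] M (Pi x (Sort s) (Var x))" ..
  with assms have "weakly_normalizing M" unfolding normalizing_def by blast
  then obtain N where N: "nf N" "M \<rightarrow>\<^sub>\<beta>\<^sup>* N" unfolding weakly_normalizing_def by blast
  from debruijn_typing(2)[OF M]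
  have "dtyping Ax Rl [] (debruijn (\<lambda>_. 0) M) (DPi (DSort s) (DVar 0))"
    by (simp add: extend_def)
  \<comment> \<open>The reduction to \<open>N\<close> is transported to de Bruijn terms, where
    subject reduction types the image of \<open>N\<close>.\<close>
  from subject_reduction_rtrancl[OF debruijn_beta_reds[OF N(2)] this]
  show False by (rule no_normal_inhabitant[OF normal_debruijn[OF N(1)]])
qed

end
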